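(* Let $A\in\mathbb{R}^{m\times n}$, $L\in\mathbb{R}^{p\times n}$ with $\mathrm{rank}((A^{\top},L^{\top})^{\top})=r$, let $M=A^{\top}A+L^{\top}L$, and let $A=P_AC_AX^{-1}$, $L=P_LS_LX^{-1}$ be a GSVD of $\{A,L\}$ (in the form given in the context) whose first $r$ right vectors satisfy $x_i\in\mathcal{R}(M)$, $1\le i\le r$. Define the linear operator $$\mathcal{L}:(\mathcal{R}(M),\langle\cdot,\cdot\rangle_M)\to(\mathbb{R}^p,\langle\cdot,\cdot\rangle_2),\quad v\mapsto Lv .$$ Partition by columns $P_L=(P_{L1}\ P_{L2}\ P_{L3})$ with $p-q_2-q_3,\ q_2,\ q_3$ columns and $X=(X_1\ X_2\ X_3\ X_4)$ with $q_1,\ q_2,\ q_3,\ n-r$ columns, and let $\widetilde X_1=(X_1\ X_2\ X_3)\in\mathbb{R}^{n\times r}$. Then the SVE of $\mathcal{L}$ has the form $$\mathcal{L}\sim P_L\Sigma_L\widetilde X_1^{\top},$$ and $$\ker(\mathcal{L})=\mathcal{R}(X_1),\quad \mathrm{im}(\mathcal{L})=\mathcal{R}((P_{L2}\ P_{L3})),\quad \ker(\mathcal{L}^* )=\mathcal{R}(P_{L1}),\quad \mathrm{im}(\mathcal{L}^* )=\mathcal{R}((X_2\ X_3)).$$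
   Context: $\mathcal{R}(\cdot)$ is the range (column space) of a matrix. For symmetric positive semidefinite $M$, $\langle v,v'\rangle_M=v^{\top}Mv'$ is an inner product on $\mathcal{R}(M)$; $\langle\cdot,\cdot\rangle_2$ is the Euclidean inner product. $\mathcal{L}^*:\mathbb{R}^p\to\mathcal{R}(M)$ is the adjoint with respect to these inner products: $\langle\mathcal{L}v,u\rangle_2=\langle v,\mathcal{L}^*u\rangle_M$ for all $v\in\mathcal{R}(M)$, $u\in\mathbb{R}^p$. SVE notation: with $r=\mathrm{rank}(M)$, $\mathcal{L}\sim H\Sigma F^{\top}$ (singular value expansion of $\mathcal{L}$) means that $F\in\mathbb{R}^{n\times r}$ has columns in $\mathcal{R}(M)$ and is $M$-orthonormal ($F^{\top}MF=I_r$), $H\in\mathbb{R}^{p\times p}$ is orthogonal, $\Sigma\in\mathbb{R}^{p\times r}$ has nonnegative entries and is diagonal up to row/column ordering (at most one nonzero entry in each row and each column), and $\mathcal{L}v=H\Sigma F^{\top}Mv$ for all $v\in\mathcal{R}(M)$ and $\mathcal{L}^*u=F\Sigma^{\top}H^{\top}u$ for all $u\in\mathbb{R}^p$. GSVD: for $A\in\mathbb{R}^{m\times n}$, $L\in\mathbb{R}^{p\times n}$ with $\mathrm{rank}((A^{\top},L^{\top})^{\top})=r$, a GSVD of $\{A,L\}$ is a pair of factorizations $A=P_AC_AX^{-1}$, $L=P_LS_LX^{-1}$ with $P_A\in\mathbb{R}^{m\times m}$, $P_L\in\mathbb{R}^{p\times p}$ orthogonal, $X=(x_1,\dots,x_n)\in\mathbb{R}^{n\times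 n}$ invertible, $C_A=(\Sigma_A\ \ \mathbf{0})\in\mathbb{R}^{m\times n}$, $S_L=(\Sigma_L\ \ \mathbf{0})\in\mathbb{R}^{p\times n}$ (the zero blocks having $n-r$ columns), where $\Sigma_A\in\mathbb{R}^{m\times r}$ and $\Sigma_L\in\mathbb{R}^{p\times r}$ are block diagonal with (possibly rectangular or empty) diagonal blocks $$\Sigma_A:\ I_{q_1},\ C_{q_2},\ \mathbf{0}_{(m-q_1-q_2)\times q_3};\qquad \Sigma_L:\ \mathbf{0}_{(p-r+q_1)\times q_1},\ S_{q_2},\ I_{q_3},$$ with $q_1+q_2+q_3=r$, $C_{q_2}=\mathrm{diag}(c_{q_1+1},\dots,c_{q_1+q_2})$, $1>c_{q_1+1}\ge\cdots\ge c_{q_1+q_2}>0$, $S_{q_2}=\mathrm{diag}(s_{q_1+1},\dots,s_{q_1+q_2})$, $0<s_{q_1+1}\le\cdots\le s_{q_1+q_2}<1$, and $\Sigma_A^{\top}\Sigma_A+\Sigma_L^{\top}\Sigma_L=I_r$. *)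

theory Defs
  imports "Jordan_Normal_Form.DL_Rank"
begin

abbreviation mat_rank :: "real mat \<Rightarrow> nat" where
  "mat_rank A \<equiv> vec_space.rank (dim_row A) A"

abbreviation mat_range :: "real mat \<Rightarrow> real vec set" where
  "mat_range A \<equiv> vec_space.col_space (dim_row A) A"

definition append_cols :: "'a :: zero mat \<Rightarrow> 'a mat \<Rightarrow> 'a mat" (infixr \<open>@\<^sub>c\<close> 65) where
  "A @\<^sub>c B = four_block_mat A B (0\<^sub>m 0 (dim_col A)) (0\<^sub>m 0 (dim_col B))"

text \<open>The constant \<^const>\<open>orthogonal_mat\<close> of the library only asks for pairwise orthogonal
  nonzero columns; here the columns are orthonormal.\<close>

definition is_orthogonal :: "nat \<Rightarrow> real mat \<Rightarrow> bool" where
  "is_orthogonal k Q \<longleftrightarrow> Q \<in> carrier_mat k k \<and> Q\<^sup>T * Q = 1\<^sub>m k \<and> Q * Q\<^sup>T = 1\<^sub>m k"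

definition inner_wrt :: "real mat \<Rightarrow> real vec \<Rightarrow> real vec \<Rightarrow> real" where
  "inner_wrt M v w = v \<bullet> (M *\<^sub>v w)"


section \<open>Operators from the range of \<open>M\<close> to Euclidean space\<close>

text \<open>An operator from \<open>mat_range M\<close>, with the inner product \<open>inner_wrt M\<close>, to
  \<open>carrier_vec p\<close>, with the Euclidean one, is a function of which only the values on
  \<open>mat_range M\<close> matter.\<close>

definition mat_operator :: "real mat \<Rightarrow> real mat \<Rightarrow> real vec \<Rightarrow> real vec" where
  "mat_operator M L = (\<lambda>v \<in> mat_range M. L *\<^sub>v v)"

definition op_kernel :: "real vec set \<Rightarrow> nat \<Rightarrow> (real vec \<Rightarrow> real vec) \<Rightarrow> real vec set" where
  "op_kernel V k T = {v \<in> V. T v = 0\<^sub>v k}"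

text \<open>For linear \<open>T\<close> and symmetric positive semidefinite \<open>M\<close>, the vector described here exists and
  is unique for every \<open>u \<in> carrier_vec p\<close>, since \<open>inner_wrt M\<close> is definite on \<open>mat_range M\<close>.\<close>

definition op_adjoint :: "real mat \<Rightarrow> (real vec \<Rightarrow> real vec) \<Rightarrow> real vec \<Rightarrow> real vec" where
  "op_adjoint M T u =
     (THE w. w \<in> mat_range M \<and> (\<forall>v \<in> mat_range M. T v \<bullet> u = inner_wrt M v w))"

definition diagonal_up_to_ordering :: "real mat \<Rightarrow> bool" where
  "diagonal_up_to_ordering S \<longleftrightarrow>
     (\<forall>i < dim_row S. \<forall>j < dim_col S. \<forall>j' < dim_col S.
        S $$ (i,j) \<noteq> 0 \<and> S $$ (i,j') \<noteq> 0 \<longrightarrow> j = j') \<and>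
     (\<forall>i < dim_row S. \<forall>i' < dim_row S. \<forall>j < dim_col S.
        S $$ (i,j) \<noteq> 0 \<and> S $$ (i',j) \<noteq> 0 \<longrightarrow> i = i')"

text \<open>\<open>is_SVE n p M T H S F\<close> says that \<open>T \<sim> H S F\<^sup>T\<close> is a singular value expansion, for
  \<open>M\<close> of size \<open>n \<times> n\<close> and \<open>T\<close> from \<open>mat_range M\<close> to \<open>carrier_vec p\<close>.\<close>

definition is_SVE ::
  "nat \<Rightarrow> nat \<Rightarrow> real mat \<Rightarrow> (real vec \<Rightarrow> real vec) \<Rightarrow> real mat \<Rightarrow> real mat \<Rightarrow> real mat \<Rightarrow> bool"
where
  "is_SVE n p M T H S F \<longleftrightarrow>
     F \<in> carrier_mat n (mat_rank M) \<and>
     (\<forall>j < mat_rank M. col F j \<in> mat_range M) \<and>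
     F\<^sup>T * M * F = 1\<^sub>m (mat_rank M) \<and>
     is_orthogonal p H \<and>
     S \<in> carrier_mat p (mat_rank M) \<and>
     (\<forall>i < p. \<forall>j < mat_rank M. 0 \<le> S $$ (i,j)) \<and>
     diagonal_up_to_ordering S \<and>
     (\<forall>v \<in> mat_range M. T v = (H * S * F\<^sup>T * M) *\<^sub>v v) \<and>
     (\<forall>u \<in> carrier_vec p. op_adjoint M T u = (F * S\<^sup>T * H\<^sup>T) *\<^sub>v u)"


section \<open>Generalized singular value decomposition\<close>

text \<open>The sequences \<open>c\<close> and \<open>s\<close> carry the indices \<open>q1 + 1, \<dots>, q1 + q2\<close>, whereas matrix
  entries are counted from \<open>0\<close>. The number \<open>p - r + q1\<close> of zero rows on top of \<open>gsvd_\<Sigma>L\<close>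
  is written \<open>p + q1 - r\<close> because subtraction is truncated.\<close>

definition gsvd_\<Sigma>A :: "nat \<Rightarrow> nat \<Rightarrow> nat \<Rightarrow> nat \<Rightarrow> (nat \<Rightarrow> real) \<Rightarrow> real mat" where
  "gsvd_\<Sigma>A m q1 q2 q3 c =
     diag_block_mat [1\<^sub>m q1, mat_diag q2 (\<lambda>i. c (q1 + 1 + i)), 0\<^sub>m (m - q1 - q2) q3]"

definition gsvd_\<Sigma>L :: "nat \<Rightarrow> nat \<Rightarrow> nat \<Rightarrow> nat \<Rightarrow> nat \<Rightarrow> (nat \<Rightarrow> real) \<Rightarrow> real mat" where
  "gsvd_\<Sigma>L p r q1 q2 q3 s =
     diag_block_mat [0\<^sub>m (p + q1 - r) q1, mat_diag q2 (\<lambda>i. s (q1 + 1 + i)), 1\<^sub>m q3]"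

text \<open>The inequalities \<open>q1 + q2 \<le> m\<close> and \<open>q2 + q3 \<le> p\<close> say that the zero blocks have
  nonnegative numbers of rows; \<open>Y\<close> is the inverse of \<open>X\<close>.\<close>

definition is_GSVD ::
  "nat \<Rightarrow> nat \<Rightarrow> nat \<Rightarrow> nat \<Rightarrow> real mat \<Rightarrow> real mat \<Rightarrow>
   nat \<Rightarrow> nat \<Rightarrow> nat \<Rightarrow> (nat \<Rightarrow> real) \<Rightarrow> (nat \<Rightarrow> real) \<Rightarrow>
   real mat \<Rightarrow> real mat \<Rightarrow> real mat \<Rightarrow> bool"
where
  "is_GSVD m n p r A L q1 q2 q3 c s PA PL X \<longleftrightarrow>
     q1 + q2 + q3 = r \<and> q1 + q2 \<le> m \<and> q2 + q3 \<le> p \<and>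
     (\<forall>i \<in> {q1+1..q1+q2}. 0 < c i \<and> c i < 1 \<and> 0 < s i \<and> s i < 1) \<and>
     (\<forall>i \<in> {q1+1..q1+q2}. \<forall>j \<in> {q1+1..q1+q2}. i \<le> j \<longrightarrow> c j \<le> c i \<and> s i \<le> s j) \<and>
     (gsvd_\<Sigma>A m q1 q2 q3 c)\<^sup>T * gsvd_\<Sigma>A m q1 q2 q3 c
       + (gsvd_\<Sigma>L p r q1 q2 q3 s)\<^sup>T * gsvd_\<Sigma>L p r q1 q2 q3 s = 1\<^sub>m r \<and>
     is_orthogonal m PA \<and> is_orthogonal p PL \<and> X \<in> carrier_mat n n \<and>
     (\<exists>Y \<in> carrier_mat n n. inverts_mat X Y \<and> inverts_mat Y X \<and>
        A = PA * (gsvd_\<Sigma>A m q1 q2 q3 c @\<^sub>c 0\<^sub>m m (n - r)) * Y \<and>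
        L = PL * (gsvd_\<Sigma>L p r q1 q2 q3 s @\<^sub>c 0\<^sub>m p (n - r)) * Y)"

end

theory Submission
  imports Defs
begin

text \<open>Let \<open>Y1\<close> consist of the first \<open>r\<close> rows of \<open>X\<^sup>-\<^sup>1\<close> and \<open>W = (X1 X2 X3)\<close>, so that \<open>Y1 * W = 1\<close>.
  The two factorizations give \<open>L = PL * \<Sigma>L * Y1\<close> and \<open>M = Y1\<^sup>T * Y1\<close>. Since the columns of \<open>W\<close> lie in
  the range of \<open>M\<close>, they form an \<open>M\<close>-orthonormal basis of it, in which the operator has the matrix
  \<open>PL * \<Sigma>L\<close> and its adjoint is \<open>u \<mapsto> W * \<Sigma>L\<^sup>T * PL\<^sup>T * u\<close>. The kernels and images can then be read off the
  block form of \<open>\<Sigma>L\<close>, whose only nonzero block is an invertible diagonal matrix.\<close>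

section \<open>Ranges and matrices split by columns\<close>

lemma mat_range_eq_image:
  assumes "A \<in> carrier_mat n k"
  shows "mat_range A = (\<lambda>x. A *\<^sub>v x) ` carrier_vec k"
  using vec_space.col_space_eq[of A "dim_row A" k] assms by auto

lemma append_cols_carrier [simp, intro]:
  "A \<in> carrier_mat n a \<Longrightarrow> B \<in> carrier_mat n b \<Longrightarrow> A @\<^sub>c B \<in> carrier_mat n (a + b)"
  by (auto simp: append_cols_def)

lemma append_cols_assoc:
  assumes "A \<in> carrier_mat n a" "B \<in> carrier_mat n b" "C \<in> carrier_mat n c"
  shows "(A @\<^sub>c B) @\<^sub>c C = A @\<^sub>c B @\<^sub>c C"
  using assms by (intro eq_matI) (auto simp: append_cols_def)

lemma append_cols_mult_vec:
  assumes "A \<in> carrier_mat n a" "B \<in> carrier_mat n b" "x \<in> carrier_vec a" "y \<in> carrier_vec b"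
  shows "(A @\<^sub>c B) *\<^sub>v (x @\<^sub>v y) = A *\<^sub>v x + B *\<^sub>v y"
proof -
  have "(A @\<^sub>c B) *\<^sub>v (x @\<^sub>v y)
      = (A *\<^sub>v x + B *\<^sub>v y) @\<^sub>v (0\<^sub>m 0 a *\<^sub>v x + 0\<^sub>m 0 b *\<^sub>v y)"
    unfolding append_cols_def using assms by (subst four_block_mat_mult_vec) auto
  then show ?thesis
    using assms by auto
qed

text \<open>Turns padding by zero columns into a factor on the right. In a GSVD this factor is
  absorbed into the inverse of \<open>X\<close>, of which it keeps only the first \<open>r\<close>
  rows.\<close>

lemma append_cols_zero_eq_mult:
  assumes "(A :: real mat) \<in> carrier_mat n a"
  shows "A @\<^sub>c 0\<^sub>m n b = A * (1\<^sub>m a @\<^sub>c 0\<^sub>m a b)"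
proof -
  \<comment> \<open>\<open>A\<close> is rewritten with empty blocks so that the product rule for
    block matrices applies.\<close>
  have "A * (1\<^sub>m a @\<^sub>c 0\<^sub>m a b)
      = four_block_mat A (0\<^sub>m n 0) (0\<^sub>m 0 a) (0\<^sub>m 0 0) * (1\<^sub>m a @\<^sub>c 0\<^sub>m a b)"
    using assms by (intro arg_cong2[where f = "(*)"] eq_matI) auto
  also have "\<dots> = A @\<^sub>c 0\<^sub>m n b"
    unfolding append_cols_def using assms
    by (subst mult_four_block_mat[of _ n a _ 0 _ 0 _ _ a _ b]) auto
  finally show ?thesis ..
qed

text \<open>The transposed selector keeps the leading block of columns. It yields both
  \<open>X * J\<^sup>T = W\<close> and \<open>J * J\<^sup>T = 1\<^sub>m r\<close> in the
  theorem.\<close>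

lemma append_cols_mult_transpose:
  assumes "(A :: real mat) \<in> carrier_mat n a" "B \<in> carrier_mat n b"
  shows "(A @\<^sub>c B) * (1\<^sub>m a @\<^sub>c 0\<^sub>m a b)\<^sup>T = A"
proof -
  have "(A @\<^sub>c B) * (1\<^sub>m a @\<^sub>c 0\<^sub>m a b)\<^sup>T
      = four_block_mat A B (0\<^sub>m 0 a) (0\<^sub>m 0 b)
        * four_block_mat (1\<^sub>m a) (0\<^sub>m a 0) (0\<^sub>m b a) (0\<^sub>m b 0)"
    unfolding append_cols_def using assms
    by (subst transpose_four_block_mat[of _ a a _ b _ 0]) auto
  also have "\<dots> = A"
    using assms by (subst mult_four_block_mat[of _ n a _ b _ 0 _ _ a _ 0]) auto
  finally show ?thesis .
qed

section \<open>Left inverses, rank, and the range of a Gram matrix\<close>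

lemma mult_mat_vec_zero:
  "(A :: real mat) \<in> carrier_mat n k \<Longrightarrow> A *\<^sub>v 0\<^sub>v k = 0\<^sub>v n"
  by (intro eq_vecI) auto

lemma mult_mat_vec_eq_zero_iff:
  assumes C: "(C :: real mat) \<in> carrier_mat n k" and B: "B \<in> carrier_mat k n"
    and BC: "B * C = 1\<^sub>m k" and x: "x \<in> carrier_vec k"
  shows "C *\<^sub>v x = 0\<^sub>v n \<longleftrightarrow> x = 0\<^sub>v k"
proof
  assume "C *\<^sub>v x = 0\<^sub>v n"
  then have "(B * C) *\<^sub>v x = 0\<^sub>v k"
    using assoc_mult_mat_vec[OF B C x] mult_mat_vec_zero[OF B] by simp
  then show "x = 0\<^sub>v k"
    using BC x by simp
qed (use mult_mat_vec_zero[OF C] in simp)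

text \<open>A left inverse makes the kernel of \<open>W\<close> trivial, so the columns are
  independent and the rank is their number.\<close>

lemma mat_rank_left_invertible:
  assumes W: "W \<in> carrier_mat n r" and Y: "Y \<in> carrier_mat r n" and YW: "Y * W = 1\<^sub>m r"
  shows "mat_rank W = r"
proof -
  have dim: "dim_row W = n" "dim_col W = r"
    using W by auto
  \<comment> \<open>Independence concerns the set of columns, which would hide a repetition.
    \<open>Y\<close> sends the columns to different unit vectors, so none is repeated.\<close>
  have "distinct (cols W)"
  proof (rule distinct_conv_nth[THEN iffD2], intro allI impI)
    fix i j assume ij: "i < length (cols W)" "j < length (cols W)" "i \<noteq> j"
    have unit: "Y *\<^sub>v col W k = unit_vec r k" if "k < r" for k
      using col_mult2[OF Y W that] that YW by simp
    have "unit_vec r i \<noteq> (unit_vec r j :: real vec)"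
      using ij dim by (auto dest: arg_cong[where f = "\<lambda>v. v $ i"])
    then have "col W i \<noteq> col W j"
      using unit[of i] unit[of j] ij dim by auto
    then show "cols W ! i \<noteq> cols W ! j"
      using ij by simp
  qed
  moreover have "v = 0\<^sub>v r" if "v \<in> carrier_vec r" "W *\<^sub>v v = 0\<^sub>v n" for v
    using mult_mat_vec_eq_zero_iff[OF W Y YW that(1)] that(2) by simp
  ultimately show ?thesis
    unfolding dim using vec_space.lin_indpt_full_rank[OF W] vec_space.lin_depE[OF W] by metis
qed

text \<open>The rank is the dimension of the span of the columns, which is the range. This carries
  the rank of \<open>W\<close> over to \<open>M\<close>.\<close>

lemma mat_rank_cong:
  assumes "dim_row A = dim_row B" "mat_range A = mat_range B"
  shows "mat_rank A = mat_rank B"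
  using assms unfolding vec_space.rank_def vec_space.col_space_def by metis

text \<open>Since \<open>Y * W = 1\<close> and \<open>W = Y\<^sup>T * (Y * Z)\<close>, the square matrix \<open>Y * Z\<close> has the left inverse
  \<open>Y * Y\<^sup>T\<close>; being square, it is inverted by it from the right as well, hence \<open>Y\<^sup>T = W * (Y * Y\<^sup>T)\<close>.\<close>

lemma mat_range_gram:
  assumes W: "W \<in> carrier_mat n r" and Y: "Y \<in> carrier_mat r n" and YW: "Y * W = 1\<^sub>m r"
    and cols: "\<forall>i < r. col W i \<in> mat_range (Y\<^sup>T * Y)"
  shows "mat_range (Y\<^sup>T * Y) = (\<lambda>x. W *\<^sub>v x) ` carrier_vec r"
proof -
  let ?M = "Y\<^sup>T * Y"
  have M: "?M \<in> carrier_mat n n"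
    using Y by auto
  from cols have "\<forall>i < r. \<exists>z \<in> carrier_vec n. col W i = ?M *\<^sub>v z"
    unfolding mat_range_eq_image[OF M] by blast
  then obtain z where z: "\<And>i. i < r \<Longrightarrow> z i \<in> carrier_vec n \<and> col W i = ?M *\<^sub>v z i"
    by metis
  \<comment> \<open>Column \<open>i\<close> of \<open>Z\<close> is a preimage of column
    \<open>i\<close> of \<open>W\<close> under \<open>?M\<close>.\<close>
  define Z where "Z = mat_of_cols n (map z [0..<r])"
  have Z: "Z \<in> carrier_mat n r"
    unfolding Z_def by (intro carrier_matI) auto
  have WZ: "W = ?M * Z"
  proof (rule mat_col_eqI)
    fix i assume i: "i < dim_col (?M * Z)"
    then have "col Z i = z i"
      using z Z unfolding Z_def by (subst col_mat_of_cols) auto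
    then show "col W i = col (?M * Z) i"
      using i Z z col_mult2[OF M Z] by simp
  qed (use W Z Y in auto)
  have "(Y * Y\<^sup>T) * (Y * Z) = Y * (?M * Z)"
    using Y Z
    by (simp add: assoc_mult_mat[of Y r n "Y\<^sup>T" r "Y * Z" r] assoc_mult_mat[of "Y\<^sup>T" n r Y n Z r])
  then have "(Y * Y\<^sup>T) * (Y * Z) = 1\<^sub>m r"
    using WZ YW by simp
  then have inv: "(Y * Z) * (Y * Y\<^sup>T) = 1\<^sub>m r"
    by (rule mat_mult_left_right_inverse[rotated 2]) (use Y Z in auto)
  have "W * (Y * Y\<^sup>T) = Y\<^sup>T * ((Y * Z) * (Y * Y\<^sup>T))"
    unfolding WZ using Y Z
    by (simp add: assoc_mult_mat[of "Y\<^sup>T" n r _ n _ r] assoc_mult_mat[of "Y\<^sup>T" n r _ r _ r])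
  then have YT: "W * (Y * Y\<^sup>T) = Y\<^sup>T"
    using inv Y by simp
  show ?thesis
  proof (intro Set.set_eqI iffI)
    fix v assume "v \<in> mat_range ?M"
    then obtain x where x: "x \<in> carrier_vec n" "v = ?M *\<^sub>v x"
      unfolding mat_range_eq_image[OF M] by blast
    \<comment> \<open>Replacing the factor \<open>Y\<^sup>T\<close> of \<open>?M\<close> exhibits
      coefficients of \<open>v\<close> with respect to the columns of \<open>W\<close>.\<close>
    have "v = (W * (Y * Y\<^sup>T)) *\<^sub>v (Y *\<^sub>v x)"
      unfolding YT x(2) using x(1) Y by (intro assoc_mult_mat_vec) auto
    also have "\<dots> = W *\<^sub>v ((Y * Y\<^sup>T) *\<^sub>v (Y *\<^sub>v x))"
      using x W Y by (intro assoc_mult_mat_vec) auto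
    finally show "v \<in> (\<lambda>x. W *\<^sub>v x) ` carrier_vec r"
      using x Y by (auto intro!: imageI)
  next
    fix v assume "v \<in> (\<lambda>x. W *\<^sub>v x) ` carrier_vec r"
    then obtain x where x: "x \<in> carrier_vec r" "v = W *\<^sub>v x"
      by blast
    have "v = ?M *\<^sub>v (Z *\<^sub>v x)"
      unfolding x(2) using x(1) Z M by (subst WZ) (rule assoc_mult_mat_vec)
    then show "v \<in> mat_range ?M"
      unfolding mat_range_eq_image[OF M] using x Z by (auto intro!: imageI)
  qed
qed

section \<open>Diagonal matrices bordered by zero blocks\<close>

lemma mat_diag_mult_vec_cancel:
  assumes "\<And>i. i < k \<Longrightarrow> d i \<noteq> 0" "x \<in> carrier_vec k"
  shows "mat_diag k d *\<^sub>v (mat_diag k (\<lambda>i. 1 / d i) *\<^sub>v x) = (x :: real vec)"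
proof -
  have "mat_diag k d * mat_diag k (\<lambda>i. 1 / d i) = 1\<^sub>m k"
    unfolding mat_diag_diag using assms(1) by (intro eq_matI) (auto simp: mat_diag_def)
  then show ?thesis
    using assms by (simp flip: assoc_mult_mat_vec[of _ k k _ k])
qed

lemma mat_diag_mult_vec_carrier [simp, intro]:
  "x \<in> carrier_vec k \<Longrightarrow> mat_diag k d *\<^sub>v x \<in> carrier_vec k"
  by (rule mult_mat_vec_carrier[OF mat_diag_dim])

lemma zero_mat_mult_vec:
  "x \<in> carrier_vec k \<Longrightarrow> 0\<^sub>m n k *\<^sub>v x = (0\<^sub>v n :: real vec)"
  by (intro eq_vecI) auto

lemma mat_diag_mult_vec_eq_zero_iff:
  assumes "\<And>i. i < k \<Longrightarrow> d i \<noteq> 0" "x \<in> carrier_vec k"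
  shows "mat_diag k d *\<^sub>v x = 0\<^sub>v k \<longleftrightarrow> x = (0\<^sub>v k :: real vec)"
proof
  assume "mat_diag k d *\<^sub>v x = 0\<^sub>v k"
  \<comment> \<open>Cancellation is applied to the reciprocals, whose own reciprocals are the
    \<open>d i\<close>.\<close>
  moreover have "mat_diag k (\<lambda>i. 1 / d i) *\<^sub>v (mat_diag k d *\<^sub>v x) = x"
    using mat_diag_mult_vec_cancel[of k "\<lambda>i. 1 / d i" x] assms by simp
  moreover have "mat_diag k (\<lambda>i. 1 / d i) *\<^sub>v 0\<^sub>v k = 0\<^sub>v k"
    by (intro eq_vecI) (auto simp: mat_diag_def)
  ultimately show "x = 0\<^sub>v k"
    by simp
next
  assume "x = 0\<^sub>v k"
  then show "mat_diag k d *\<^sub>v x = 0\<^sub>v k"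
    by (auto simp: mat_diag_def)
qed

text \<open>Common shape of \<open>gsvd_\<Sigma>L\<close> and its transpose: transposition only
  swaps \<open>z\<close> and \<open>q\<close>. Hence one image lemma and one kernel lemma serve both
  the operator and its adjoint.\<close>

definition corner_diag :: "nat \<Rightarrow> nat \<Rightarrow> nat \<Rightarrow> (nat \<Rightarrow> real) \<Rightarrow> real mat" where
  "corner_diag z q k d = four_block_mat (0\<^sub>m z q) (0\<^sub>m z k) (0\<^sub>m k q) (mat_diag k d)"

lemma corner_diag_carrier [simp, intro]: "corner_diag z q k d \<in> carrier_mat (z + k) (q + k)"
  by (auto simp: corner_diag_def)

lemma corner_diag_transpose: "(corner_diag z q k d)\<^sup>T = corner_diag q z k d"
  by (intro eq_matI) (auto simp: corner_diag_def mat_diag_def)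

lemma corner_diag_index:
  "i < z + k \<Longrightarrow> j < q + k \<Longrightarrow>
   corner_diag z q k d $$ (i, j) = (if z \<le> i \<and> q \<le> j \<and> i - z = j - q then d (j - q) else 0)"
  by (auto simp: corner_diag_def mat_diag_def)

lemma diagonal_up_to_ordering_corner_diag: "diagonal_up_to_ordering (corner_diag z q k d)"
  unfolding diagonal_up_to_ordering_def
  by (auto simp: carrier_matD[OF corner_diag_carrier] corner_diag_index split: if_splits)

lemma corner_diag_mult_vec:
  assumes "a \<in> carrier_vec q" "b \<in> carrier_vec k"
  shows "corner_diag z q k d *\<^sub>v (a @\<^sub>v b) = 0\<^sub>v z @\<^sub>v mat_diag k d *\<^sub>v b"
  unfolding corner_diag_def using assms
  by (subst four_block_mat_mult_vec[of _ z q _ k _ k])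
    (auto simp: zero_mat_mult_vec left_zero_vec[OF mat_diag_mult_vec_carrier])

text \<open>The \<open>z\<close> leading output coordinates vanish, so \<open>B\<close> contributes
  nothing. The diagonal block is onto because its entries are nonzero, so all of the range of
  \<open>C\<close> is reached.\<close>

lemma image_mult_corner_diag:
  assumes B: "B \<in> carrier_mat n z" "C \<in> carrier_mat n k" and d: "\<And>i. i < k \<Longrightarrow> d i \<noteq> 0"
  shows "(\<lambda>x. (B @\<^sub>c C) *\<^sub>v (corner_diag z q k d *\<^sub>v x)) ` carrier_vec (q + k) = mat_range C"
proof -
  have *: "(B @\<^sub>c C) *\<^sub>v (corner_diag z q k d *\<^sub>v (a @\<^sub>v b)) = C *\<^sub>v (mat_diag k d *\<^sub>v b)"
    if "a \<in> carrier_vec q" "b \<in> carrier_vec k" for a b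
    using that B mult_mat_vec_carrier[OF B(2) mat_diag_mult_vec_carrier[of b k d]]
    by (auto simp: corner_diag_mult_vec append_cols_mult_vec mult_mat_vec_zero)
  show ?thesis
    unfolding mat_range_eq_image[OF B(2)]
  proof (intro Set.set_eqI iffI)
    fix y assume "y \<in> (\<lambda>x. (B @\<^sub>c C) *\<^sub>v (corner_diag z q k d *\<^sub>v x)) ` carrier_vec (q + k)"
    then obtain x where x: "x \<in> carrier_vec (q + k)"
      "y = (B @\<^sub>c C) *\<^sub>v (corner_diag z q k d *\<^sub>v x)"
      by blast
    then have "y = C *\<^sub>v (mat_diag k d *\<^sub>v vec_last x k)"
      using *[of "vec_first x q" "vec_last x k"] by simp
    then show "y \<in> (\<lambda>x. C *\<^sub>v x) ` carrier_vec k"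
      by (auto intro!: imageI)
  next
    fix y assume "y \<in> (\<lambda>x. C *\<^sub>v x) ` carrier_vec k"
    then obtain b where b: "b \<in> carrier_vec k" "y = C *\<^sub>v b"
      by blast
    \<comment> \<open>The preimage divides the coordinates of \<open>b\<close> by the diagonal
      entries; its first \<open>q\<close> coordinates are arbitrary and are set to zero.\<close>
    then have "y = (B @\<^sub>c C) *\<^sub>v (corner_diag z q k d *\<^sub>v (0\<^sub>v q @\<^sub>v mat_diag k (\<lambda>i. 1 / d i) *\<^sub>v b))"
      using *[of "0\<^sub>v q" "mat_diag k (\<lambda>i. 1 / d i) *\<^sub>v b"] mat_diag_mult_vec_cancel[OF d] by simp
    then show "y \<in> (\<lambda>x. (B @\<^sub>c C) *\<^sub>v (corner_diag z q k d *\<^sub>v x)) ` carrier_vec (q + k)"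
      using b by (auto intro!: imageI)
  qed
qed

text \<open>An injective diagonal block leaves exactly the vectors
  \<open>a @\<^sub>v 0\<^sub>v k\<close> in the kernel, and on these only \<open>B\<close>
  acts.\<close>

lemma image_kernel_corner_diag:
  assumes B: "B \<in> carrier_mat n q" "C \<in> carrier_mat n k" and d: "\<And>i. i < k \<Longrightarrow> d i \<noteq> 0"
  shows "(\<lambda>x. (B @\<^sub>c C) *\<^sub>v x) ` {x \<in> carrier_vec (q + k). corner_diag z q k d *\<^sub>v x = 0\<^sub>v (z + k)}
    = mat_range B"
proof -
  have "{x \<in> carrier_vec (q + k). corner_diag z q k d *\<^sub>v x = 0\<^sub>v (z + k)}
      = (\<lambda>a. a @\<^sub>v 0\<^sub>v k) ` carrier_vec q"
  proof (intro Set.set_eqI iffI)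
    fix x assume "x \<in> {x \<in> carrier_vec (q + k). corner_diag z q k d *\<^sub>v x = 0\<^sub>v (z + k)}"
    then have x: "x \<in> carrier_vec (q + k)" "corner_diag z q k d *\<^sub>v x = 0\<^sub>v (z + k)"
      by auto
    then have split: "x = vec_first x q @\<^sub>v vec_last x k"
      by simp
    have "0\<^sub>v z @\<^sub>v mat_diag k d *\<^sub>v vec_last x k = 0\<^sub>v z @\<^sub>v 0\<^sub>v k"
      using x(2) by (subst (asm) split) (auto simp: corner_diag_mult_vec)
    then have "vec_last x k = 0\<^sub>v k"
      using d by (subst (asm) append_vec_eq[of _ z]) (auto simp: mat_diag_mult_vec_eq_zero_iff)
    then show "x \<in> (\<lambda>a. a @\<^sub>v 0\<^sub>v k) ` carrier_vec q"
      using split by (metis imageI vec_first_carrier)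
  next
    fix x :: "real vec" assume "x \<in> (\<lambda>a. a @\<^sub>v 0\<^sub>v k) ` carrier_vec q"
    then show "x \<in> {x \<in> carrier_vec (q + k). corner_diag z q k d *\<^sub>v x = 0\<^sub>v (z + k)}"
      by (auto simp: corner_diag_mult_vec mult_mat_vec_zero[OF mat_diag_dim])
  qed
  moreover have "(B @\<^sub>c C) *\<^sub>v (a @\<^sub>v 0\<^sub>v k) = B *\<^sub>v a" if "a \<in> carrier_vec q" for a
    using that B mult_mat_vec_carrier[OF B(1) that]
    by (auto simp: append_cols_mult_vec mult_mat_vec_zero)
  ultimately show ?thesis
    unfolding mat_range_eq_image[OF B(1)] by (simp add: image_image)
qed

text \<open>The blocks \<open>S_{q2}\<close> and \<open>I_{q3}\<close> are adjacent on the diagonal,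
  so they merge into one diagonal block of size \<open>q2 + q3\<close>.\<close>

lemma gsvd_\<Sigma>L_eq_corner_diag:
  "gsvd_\<Sigma>L p r q1 q2 q3 s
    = corner_diag (p + q1 - r) q1 (q2 + q3) (\<lambda>j. if j < q2 then s (q1 + 1 + j) else 1)"
proof -
  \<comment> \<open>An arbitrary \<open>z\<close> keeps the truncated subtraction out of the
    comparison of entries.\<close>
  have "diag_block_mat [0\<^sub>m z q1, mat_diag q2 (\<lambda>i. s (q1 + 1 + i)), 1\<^sub>m q3]
      = corner_diag z q1 (q2 + q3) (\<lambda>j. if j < q2 then s (q1 + 1 + j) else 1)" for z
    unfolding corner_diag_def diag_block_mat.simps(2)[of _ "B # Bs" for B Bs]
      diag_block_mat_singleton Let_def
    by (intro eq_matI) (auto simp: mat_diag_def)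
  then show ?thesis
    unfolding gsvd_\<Sigma>L_def .
qed

section \<open>Gram matrices and adjoints\<close>

lemma gsvd_\<Sigma>A_carrier:
  "q1 + q2 \<le> m \<Longrightarrow> gsvd_\<Sigma>A m q1 q2 q3 c \<in> carrier_mat m (q1 + q2 + q3)"
  unfolding gsvd_\<Sigma>A_def by (intro carrier_matI) (auto simp: dim_diag_block_mat mat_diag_def)

text \<open>The orthogonal factor cancels through \<open>P\<^sup>T * P = 1\<^sub>m k\<close>.
  Applied to \<open>A\<close> and to \<open>L\<close>, this brings the two terms of \<open>M\<close>
  into a form to which the normalization of the GSVD applies.\<close>

lemma gram_orthogonal_mult:
  assumes "is_orthogonal k P" "S \<in> carrier_mat k r" "Y \<in> carrier_mat r n"
  shows "(P * S * Y)\<^sup>T * (P * S * Y) = Y\<^sup>T * (S\<^sup>T * S) * Y"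
proof -
  have P: "P \<in> carrier_mat k k" "P\<^sup>T * P = 1\<^sub>m k"
    using assms(1) by (auto simp: is_orthogonal_def)
  have "P\<^sup>T * (P * (S * Y)) = (P\<^sup>T * P) * (S * Y)"
    using assms P by (intro assoc_mult_mat[symmetric]) auto
  then have "P\<^sup>T * (P * (S * Y)) = S * Y"
    using P assms by simp
  moreover have "P * S * Y = P * (S * Y)"
    using P assms by (intro assoc_mult_mat) auto
  moreover have "(P * (S * Y))\<^sup>T = Y\<^sup>T * S\<^sup>T * P\<^sup>T"
    using P assms by (simp add: transpose_mult[of _ k k _ n] transpose_mult[of _ k r _ n])
  moreover have "Y\<^sup>T * S\<^sup>T * P\<^sup>T * (P * (S * Y)) = Y\<^sup>T * S\<^sup>T * (P\<^sup>T * (P * (S * Y)))"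
    using P assms by (intro assoc_mult_mat[of _ n k _ k]) auto
  moreover have "Y\<^sup>T * S\<^sup>T * (S * Y) = Y\<^sup>T * S\<^sup>T * S * Y"
    using assms by (intro assoc_mult_mat[symmetric]) auto
  moreover have "Y\<^sup>T * S\<^sup>T * S = Y\<^sup>T * (S\<^sup>T * S)"
    using assms by (intro assoc_mult_mat) auto
  ultimately show ?thesis
    by metis
qed

text \<open>Existence: \<open>adj\<close> moves \<open>L\<close> to the other side of the inner
  product. Uniqueness: in coordinates with respect to \<open>W\<close> the \<open>M\<close>-inner
  product is the Euclidean one, hence definite.\<close>

lemma op_adjoint_mat_operator:
  assumes M: "M \<in> carrier_mat n n" and W: "W \<in> carrier_mat n r"
    and range: "mat_range M = (\<lambda>x. W *\<^sub>v x) ` carrier_vec r"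
    and orth: "W\<^sup>T * M * W = 1\<^sub>m r"
    and L: "L \<in> carrier_mat p n" and B: "B \<in> carrier_mat r p"
    and adj: "M * (W * B) = L\<^sup>T"
    and u: "u \<in> carrier_vec p"
  shows "op_adjoint M (mat_operator M L) u = (W * B) *\<^sub>v u"
proof -
  have T: "mat_operator M L v \<bullet> u = inner_wrt M v ((W * B) *\<^sub>v u)" if "v \<in> mat_range M" for v
  proof -
    have v: "v \<in> carrier_vec n"
      using that W unfolding range by auto
    have "mat_operator M L v \<bullet> u = u \<bullet> (L *\<^sub>v v)"
      using that v u L by (auto simp: mat_operator_def intro!: comm_scalar_prod)
    also have "\<dots> = (L\<^sup>T *\<^sub>v u) \<bullet> v"
      using v u L by (intro transpose_vec_mult_scalar[symmetric])
    also have "\<dots> = v \<bullet> (L\<^sup>T *\<^sub>v u)"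
      using v u L by (intro comm_scalar_prod) auto
    also have "L\<^sup>T *\<^sub>v u = M *\<^sub>v ((W * B) *\<^sub>v u)"
      unfolding adj[symmetric] using M W B u by (intro assoc_mult_mat_vec) auto
    finally show ?thesis
      by (simp add: inner_wrt_def)
  qed
  have inner: "inner_wrt M (W *\<^sub>v a) (W *\<^sub>v b) = b \<bullet> a"
    if ab: "a \<in> carrier_vec r" "b \<in> carrier_vec r" for a b
  proof -
    have "inner_wrt M (W *\<^sub>v a) (W *\<^sub>v b) = (M *\<^sub>v (W *\<^sub>v b)) \<bullet> (W *\<^sub>v a)"
      unfolding inner_wrt_def using ab M W
      by (intro comm_scalar_prod[of _ n] mult_mat_vec_carrier[OF M] mult_mat_vec_carrier[OF W])
    also have "\<dots> = (W\<^sup>T *\<^sub>v (M *\<^sub>v (W *\<^sub>v b))) \<bullet> a"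
      using ab W mult_mat_vec_carrier[OF M mult_mat_vec_carrier[OF W ab(2)]]
      by (intro transpose_vec_mult_scalar[symmetric])
    also have "W\<^sup>T *\<^sub>v (M *\<^sub>v (W *\<^sub>v b)) = (W\<^sup>T * M * W) *\<^sub>v b"
      using ab W M
      by (simp add: assoc_mult_mat_vec[of "W\<^sup>T" r n "M * W" r] assoc_mult_mat_vec[of M n n W r])
    finally show ?thesis
      using ab orth by simp
  qed
  have WBu: "(W * B) *\<^sub>v u = W *\<^sub>v (B *\<^sub>v u)" "B *\<^sub>v u \<in> carrier_vec r"
    using W B u by auto
  show ?thesis
    unfolding op_adjoint_def
  proof (intro the_equality conjI ballI)
    show "(W * B) *\<^sub>v u \<in> mat_range M"
      unfolding range WBu(1) using WBu(2) by (rule imageI)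
  next
    fix w assume w: "w \<in> mat_range M \<and>
      (\<forall>v \<in> mat_range M. mat_operator M L v \<bullet> u = inner_wrt M v w)"
    then obtain b where b: "b \<in> carrier_vec r" "w = W *\<^sub>v b"
      unfolding range by blast
    \<comment> \<open>Testing against column \<open>i\<close> of \<open>W\<close> reads off
      coordinate \<open>i\<close>.\<close>
    have "b $ i = (B *\<^sub>v u) $ i" if "i < r" for i
    proof -
      have i: "unit_vec r i \<in> carrier_vec r"
        by simp
      then have "W *\<^sub>v unit_vec r i \<in> mat_range M"
        unfolding range by (rule imageI)
      then have "inner_wrt M (W *\<^sub>v unit_vec r i) (W *\<^sub>v b)
          = inner_wrt M (W *\<^sub>v unit_vec r i) (W *\<^sub>v (B *\<^sub>v u))"
        using w T unfolding b(2) WBu(1) by metis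
      then show ?thesis
        unfolding inner[OF i b(1)] inner[OF i WBu(2)] using that b(1) WBu(2) by simp
    qed
    then have "b = B *\<^sub>v u"
      using b(1) B by (intro eq_vecI) auto
    then show "w = (W * B) *\<^sub>v u"
      by (simp add: b(2) WBu(1))
  qed (use T in auto)
qed

section \<open>The singular value expansion and the four subspaces\<close>

theorem theorem3p3:
  fixes m n p r q1 q2 q3 :: nat
    and A L M PA PL X PL1 PL2 PL3 X1 X2 X3 X4 :: "real mat"
    and c s :: "nat \<Rightarrow> real"
    and T :: "real vec \<Rightarrow> real vec"
  assumes "A \<in> carrier_mat m n" and "L \<in> carrier_mat p n"
    and "mat_rank (A @\<^sub>r L) = r"
    and "M = A\<^sup>T * A + L\<^sup>T * L"
    and "is_GSVD m n p r A L q1 q2 q3 c s PA PL X"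
    and "\<forall>i < r. col X i \<in> mat_range M"
    and "T = mat_operator M L"
    and "PL1 \<in> carrier_mat p (p - q2 - q3)" and "PL2 \<in> carrier_mat p q2"
    and "PL3 \<in> carrier_mat p q3" and "PL = PL1 @\<^sub>c PL2 @\<^sub>c PL3"
    and "X1 \<in> carrier_mat n q1" and "X2 \<in> carrier_mat n q2"
    and "X3 \<in> carrier_mat n q3" and "X4 \<in> carrier_mat n (n - r)"
    and "X = X1 @\<^sub>c X2 @\<^sub>c X3 @\<^sub>c X4"
  shows "is_SVE n p M T PL (gsvd_\<Sigma>L p r q1 q2 q3 s) (X1 @\<^sub>c X2 @\<^sub>c X3) \<and>
    op_kernel (mat_range M) p T = mat_range X1 \<and>
    T ` mat_range M = mat_range (PL2 @\<^sub>c PL3) \<and>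
    op_kernel (carrier_vec p) n (op_adjoint M T) = mat_range PL1 \<and>
    op_adjoint M T ` carrier_vec p = mat_range (X2 @\<^sub>c X3)"
proof -
  note blocks = assms(8-10,12-15)
  let ?SA = "gsvd_\<Sigma>A m q1 q2 q3 c"
  define d where "d j = (if j < q2 then s (q1 + 1 + j) else 1)" for j
  define z where "z = p - q2 - q3"
  define k where "k = q2 + q3"
  define S where "S = gsvd_\<Sigma>L p r q1 q2 q3 s"
  define W where "W = X1 @\<^sub>c X2 @\<^sub>c X3"
  \<comment> \<open>\<open>J\<close> selects the first \<open>r\<close> coordinates:
    \<open>J * Y\<close> is the top of \<open>Y\<close>, and \<open>X * J\<^sup>T\<close> is the
    left part of \<open>X\<close>.\<close>
  define J where "J = (1\<^sub>m r @\<^sub>c 0\<^sub>m r (n - r) :: real mat)"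
  have q: "q1 + q2 + q3 = r" "q1 + q2 \<le> m" "q2 + q3 \<le> p"
    and s_pos: "\<forall>i \<in> {q1+1..q1+q2}. 0 < s i"
    and \<Sigma>: "?SA\<^sup>T * ?SA + S\<^sup>T * S = 1\<^sub>m r"
    and orth: "is_orthogonal m PA" "is_orthogonal p PL" and X: "X \<in> carrier_mat n n"
    using assms(5) unfolding is_GSVD_def S_def by blast+
  obtain Y where Y: "Y \<in> carrier_mat n n" and YX: "Y * X = 1\<^sub>m n"
    and A: "A = PA * (?SA @\<^sub>c 0\<^sub>m m (n - r)) * Y"
    and L: "L = PL * (S @\<^sub>c 0\<^sub>m p (n - r)) * Y"
    using assms(5) unfolding is_GSVD_def S_def inverts_mat_def by fastforce
  \<comment> \<open>No subtraction truncates here, because \<open>q2 + q3\<close> is at most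
    \<open>p\<close>.\<close>
  have dims: "p = z + k" "r = q1 + k" "z = p + q1 - r"
    using q by (auto simp: z_def k_def)
  \<comment> \<open>For \<open>i < q2\<close> the shifted index \<open>q1 + 1 + i\<close> lies where
    \<open>s\<close> is positive; for all other \<open>i\<close> the value is 1.\<close>
  have d_pos: "0 < d i" for i
    using s_pos by (cases "i < q2") (auto simp: d_def)
  then have d0: "d i \<noteq> 0" for i
    by (metis less_irrefl)
  have S_eq: "S = corner_diag z q1 k d"
    unfolding S_def gsvd_\<Sigma>L_eq_corner_diag dims(3) k_def d_def ..
  have S: "S \<in> carrier_mat p r"
    unfolding S_eq dims(1,2) by simp
  have SA: "?SA \<in> carrier_mat m r"
    using gsvd_\<Sigma>A_carrier[OF q(2)] q(1) by metis
  have P: "PL \<in> carrier_mat p p" "PL\<^sup>T * PL = 1\<^sub>m p" "PL * PL\<^sup>T = 1\<^sub>m p"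
    and PA: "PA \<in> carrier_mat m m"
    using orth by (auto simp: is_orthogonal_def)
  have X23: "X2 @\<^sub>c X3 \<in> carrier_mat n k" and P23: "PL2 @\<^sub>c PL3 \<in> carrier_mat p k"
    and P1: "PL1 \<in> carrier_mat p z"
    using blocks by (auto simp: k_def z_def)
  have W: "W \<in> carrier_mat n r"
    unfolding W_def dims(2) using blocks X23 by simp
  have X_eq: "X = W @\<^sub>c X4"
    unfolding W_def assms(16)
    using append_cols_assoc[OF blocks(4) X23 blocks(7)] append_cols_assoc[OF blocks(5-7)] by simp
  \<comment> \<open>Counting the columns of \<open>X\<close> in two ways shows that
    \<open>n - r\<close> does not truncate.\<close>
  have rn: "r + (n - r) = n"
    using append_cols_carrier[OF W blocks(7)] X unfolding X_eq by (metis carrier_matD(2))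
  have J: "J \<in> carrier_mat r n"
    using append_cols_carrier[of "1\<^sub>m r :: real mat" r r "0\<^sub>m r (n - r)" "n - r"] rn
    unfolding J_def by simp
  define Y1 where "Y1 = J * Y"
  have Y1: "Y1 \<in> carrier_mat r n"
    using J Y by (simp add: Y1_def)
  have JJ: "J * J\<^sup>T = 1\<^sub>m r" and XJ: "X * J\<^sup>T = W"
    unfolding X_eq J_def using W blocks(7) by (auto intro!: append_cols_mult_transpose)
  have "Y1 * W = J * (Y * X) * J\<^sup>T"
    unfolding Y1_def XJ[symmetric] using J X Y
    by (simp add: assoc_mult_mat[of _ r n _ n _ r] assoc_mult_mat[of _ n n _ n _ r])
  then have Y1W: "Y1 * W = 1\<^sub>m r"
    using YX J JJ by simp
  have factor: "P' * (S' @\<^sub>c 0\<^sub>m l (n - r)) * Y = P' * S' * Y1"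
    if "P' \<in> carrier_mat l l" "S' \<in> carrier_mat l r" for P' S' l
    unfolding append_cols_zero_eq_mult[OF that(2)] Y1_def J_def[symmetric] using that J Y
    by (simp add: assoc_mult_mat[of _ l r _ n _ n] assoc_mult_mat[of _ l l _ n _ n]
        assoc_mult_mat[of _ l l _ r _ n])
  have A_eq: "A = PA * ?SA * Y1" and L_eq: "L = PL * S * Y1"
    unfolding A L using factor PA P(1) S SA by auto
  have "M = Y1\<^sup>T * (?SA\<^sup>T * ?SA) * Y1 + Y1\<^sup>T * (S\<^sup>T * S) * Y1"
    unfolding assms(4) A_eq L_eq using orth SA S Y1 by (simp add: gram_orthogonal_mult)
  also have "\<dots> = Y1\<^sup>T * (?SA\<^sup>T * ?SA + S\<^sup>T * S) * Y1"
    using SA S Y1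
    by (simp add: mult_add_distrib_mat[of _ n r _ r] add_mult_distrib_mat[of _ n r _ _ n])
  \<comment> \<open>The middle factor is the identity by the normalization of the GSVD.\<close>
  finally have M_eq: "M = Y1\<^sup>T * Y1"
    unfolding \<Sigma> using Y1 by simp
  then have M: "M \<in> carrier_mat n n"
    using Y1 by simp
  have "col W i = col X i" if "i < r" for i
    using that W blocks(7) unfolding X_eq by (intro eq_vecI) (auto simp: append_cols_def)
  \<comment> \<open>The hypothesis that the first \<open>r\<close> right vectors lie in the range of
    \<open>M\<close> enters here.\<close>
  then have range: "mat_range M = (\<lambda>x. W *\<^sub>v x) ` carrier_vec r"
    using assms(6) unfolding M_eq by (intro mat_range_gram[OF W Y1 Y1W]) simp
  have rank: "mat_rank M = r"
    using mat_rank_left_invertible[OF W Y1 Y1W] mat_rank_cong[of M W] range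
      mat_range_eq_image[OF W] M W by simp
  have WY: "W\<^sup>T * Y1\<^sup>T = 1\<^sub>m r"
    using transpose_mult[OF Y1 W] by (simp add: Y1W)
  \<comment> \<open>This gives both the \<open>M\<close>-orthonormality of \<open>W\<close> and,
    with \<open>L_eq\<close>, the expansion \<open>L = PL * S * W\<^sup>T * M\<close>.\<close>
  have WM: "W\<^sup>T * M = Y1"
    using assoc_mult_mat[of "W\<^sup>T" r n "Y1\<^sup>T" r Y1 n] W Y1 by (simp add: M_eq WY)
  have MW: "M * W = Y1\<^sup>T"
    using assoc_mult_mat[of "Y1\<^sup>T" n r Y1 n W r] W Y1 by (simp add: M_eq Y1W)
  have T: "T v = L *\<^sub>v v" if "v \<in> mat_range M" for v
    using that by (simp add: assms(7) mat_operator_def)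
  have TW: "T (W *\<^sub>v a) = PL *\<^sub>v (S *\<^sub>v a)" if "a \<in> carrier_vec r" for a
  proof -
    have "L * W = PL * S * (Y1 * W)"
      unfolding L_eq using P S W Y1 by (intro assoc_mult_mat) auto
    then have "L * W = PL * S"
      using P S Y1W by simp
    moreover have "T (W *\<^sub>v a) = (L * W) *\<^sub>v a"
      using that W assms(2) range T by simp
    ultimately show ?thesis
      using that P S by simp
  qed
  have SP: "S\<^sup>T * PL\<^sup>T \<in> carrier_mat r p"
    using S P by simp
  have adj: "M * (W * (S\<^sup>T * PL\<^sup>T)) = L\<^sup>T"
  proof -
    have "M * (W * (S\<^sup>T * PL\<^sup>T)) = M * W * (S\<^sup>T * PL\<^sup>T)"
      using M W SP by (intro assoc_mult_mat[symmetric])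
    also have "\<dots> = L\<^sup>T"
      unfolding MW L_eq using P S Y1
      by (simp add: transpose_mult[of _ p r _ n] transpose_mult[of _ p p _ n])
    finally show ?thesis .
  qed
  have T': "op_adjoint M T u = W *\<^sub>v (S\<^sup>T *\<^sub>v (PL\<^sup>T *\<^sub>v u))" if u: "u \<in> carrier_vec p" for u
  proof -
    have "op_adjoint M T u = (W * (S\<^sup>T * PL\<^sup>T)) *\<^sub>v u"
      unfolding assms(7)
      by (rule op_adjoint_mat_operator[OF M W range _ assms(2) SP adj u]) (simp add: WM Y1W)
    then show ?thesis
      using u W S P SP by (simp add: assoc_mult_mat_vec[of _ n r _ p] assoc_mult_mat_vec[of _ r p _ p])
  qed
  have ST: "S\<^sup>T = corner_diag q1 z k d"
    by (simp add: S_eq corner_diag_transpose)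
  have PL_eq: "PL = PL1 @\<^sub>c (PL2 @\<^sub>c PL3)" and W_eq: "W = X1 @\<^sub>c (X2 @\<^sub>c X3)"
    by (simp_all add: assms(11) W_def)
  have PT: "PL\<^sup>T \<in> carrier_mat p p"
    using P by simp
  \<comment> \<open>\<open>PL\<^sup>T\<close> permutes \<open>carrier_vec p\<close> bijectively with
    inverse \<open>PL\<close>, so conditions on \<open>PL\<^sup>T *\<^sub>v u\<close> can be
    restated in the new coordinates.\<close>
  have P_image: "(\<lambda>u. PL\<^sup>T *\<^sub>v u) ` carrier_vec p = carrier_vec p"
    "{u \<in> carrier_vec p. Q (PL\<^sup>T *\<^sub>v u)} = (\<lambda>x. PL *\<^sub>v x) ` {x \<in> carrier_vec p. Q x}" for Q
  proof -
    have *: "PL *\<^sub>v (PL\<^sup>T *\<^sub>v x) = x" "PL\<^sup>T *\<^sub>v (PL *\<^sub>v x) = x"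
      "PL\<^sup>T *\<^sub>v x \<in> carrier_vec p" "PL *\<^sub>v x \<in> carrier_vec p" if "x \<in> carrier_vec p" for x
      using that P PT mult_mat_vec_carrier[OF PT that]
      by (simp_all flip: assoc_mult_mat_vec[of _ p p _ p])
    have img: "x = PL\<^sup>T *\<^sub>v (PL *\<^sub>v x)" "x = PL *\<^sub>v (PL\<^sup>T *\<^sub>v x)" if "x \<in> carrier_vec p" for x
      using *(1,2)[OF that] by simp_all
    show "(\<lambda>u. PL\<^sup>T *\<^sub>v u) ` carrier_vec p = carrier_vec p"
    proof (intro equalityI subsetI)
      fix u :: "real vec" assume "u \<in> carrier_vec p"
      then show "u \<in> (\<lambda>u. PL\<^sup>T *\<^sub>v u) ` carrier_vec p"
        using img(1)[of u] *(4) by (intro image_eqI[of _ _ "PL *\<^sub>v u"]) auto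
    qed (use * in auto)
    show "{u \<in> carrier_vec p. Q (PL\<^sup>T *\<^sub>v u)} = (\<lambda>x. PL *\<^sub>v x) ` {x \<in> carrier_vec p. Q x}"
    proof (intro equalityI subsetI)
      fix u assume "u \<in> {u \<in> carrier_vec p. Q (PL\<^sup>T *\<^sub>v u)}"
      then show "u \<in> (\<lambda>x. PL *\<^sub>v x) ` {x \<in> carrier_vec p. Q x}"
        using img(2)[of u] *(3) by (intro image_eqI[of _ _ "PL\<^sup>T *\<^sub>v u"]) auto
    qed (use * in auto)
  qed

  have "is_SVE n p M T PL S W"
    unfolding is_SVE_def rank
  proof (intro conjI allI ballI impI)
    show "col W j \<in> mat_range M" if "j < r" for j
      using that \<open>\<And>i. i < r \<Longrightarrow> col W i = col X i\<close> assms(6) by simp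
    show "W\<^sup>T * M * W = 1\<^sub>m r"
      by (simp add: WM Y1W)
    show "0 \<le> S $$ (i, j)" if "i < p" "j < r" for i j
      using that less_imp_le[OF d_pos] unfolding S_eq dims(1,2) by (simp add: corner_diag_index)
    show "diagonal_up_to_ordering S"
      unfolding S_eq by (rule diagonal_up_to_ordering_corner_diag)
    show "T v = (PL * S * W\<^sup>T * M) *\<^sub>v v" if "v \<in> mat_range M" for v
    proof -
      have "PL * S * W\<^sup>T * M = PL * S * (W\<^sup>T * M)"
        using P S W M by (intro assoc_mult_mat) auto
      then show ?thesis
        using T[OF that] by (simp add: WM L_eq)
    qed
    show "op_adjoint M T u = (W * S\<^sup>T * PL\<^sup>T) *\<^sub>v u" if u: "u \<in> carrier_vec p" for u
      using T'[OF u] u W S P mult_mat_vec_carrier[OF PT u]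
      by (simp add: assoc_mult_mat_vec[of _ n r _ p] assoc_mult_mat_vec[of _ n p _ p])
  qed (use W orth S in auto)
  moreover have "op_kernel (mat_range M) p T = mat_range X1"
  proof -
    have "op_kernel (mat_range M) p T = (\<lambda>x. W *\<^sub>v x) ` {x \<in> carrier_vec r. T (W *\<^sub>v x) = 0\<^sub>v p}"
      unfolding op_kernel_def range by auto
    \<comment> \<open>\<open>PL\<close> is injective, so only the kernel of \<open>S\<close>
      remains.\<close>
    also have "{x \<in> carrier_vec r. T (W *\<^sub>v x) = 0\<^sub>v p} = {x \<in> carrier_vec r. S *\<^sub>v x = 0\<^sub>v p}"
      using TW mult_mat_vec_eq_zero_iff[OF P(1) PT P(2)] mult_mat_vec_carrier[OF S] by auto
    also have "(\<lambda>x. W *\<^sub>v x) ` \<dots> = mat_range X1"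
      unfolding W_eq S_eq dims(1,2) by (rule image_kernel_corner_diag[OF blocks(4) X23 d0])
    finally show ?thesis .
  qed
  moreover have "T ` mat_range M = mat_range (PL2 @\<^sub>c PL3)"
  proof -
    have "T ` mat_range M = (\<lambda>x. PL *\<^sub>v (S *\<^sub>v x)) ` carrier_vec r"
      unfolding range image_image using TW by (intro image_cong) auto
    also have "\<dots> = mat_range (PL2 @\<^sub>c PL3)"
      unfolding PL_eq S_eq dims(2) by (rule image_mult_corner_diag[OF P1 P23 d0])
    finally show ?thesis .
  qed
  moreover have "op_kernel (carrier_vec p) n (op_adjoint M T) = mat_range PL1"
  proof -
    have "op_kernel (carrier_vec p) n (op_adjoint M T)
        = {u \<in> carrier_vec p. S\<^sup>T *\<^sub>v (PL\<^sup>T *\<^sub>v u) = 0\<^sub>v r}"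
      unfolding op_kernel_def using T' mult_mat_vec_eq_zero_iff[OF W Y1 Y1W] S
        mult_mat_vec_carrier[of "S\<^sup>T" r p, OF _ mult_mat_vec_carrier[OF PT]] by auto
    also have "\<dots> = (\<lambda>x. PL *\<^sub>v x) ` {x \<in> carrier_vec p. S\<^sup>T *\<^sub>v x = 0\<^sub>v r}"
      by (rule P_image)
    also have "\<dots> = mat_range PL1"
      unfolding PL_eq ST dims(1,2) by (rule image_kernel_corner_diag[OF P1 P23 d0])
    finally show ?thesis .
  qed
  moreover have "op_adjoint M T ` carrier_vec p = mat_range (X2 @\<^sub>c X3)"
  proof -
    have "op_adjoint M T ` carrier_vec p
        = (\<lambda>x. W *\<^sub>v (S\<^sup>T *\<^sub>v x)) ` (\<lambda>u. PL\<^sup>T *\<^sub>v u) ` carrier_vec p"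
      unfolding image_image using T' by (intro image_cong) auto
    also have "\<dots> = (\<lambda>x. W *\<^sub>v (S\<^sup>T *\<^sub>v x)) ` carrier_vec p"
      unfolding P_image ..
    \<comment> \<open>For the transpose the zero blocks trade places: \<open>X1\<close> now meets
      the zero rows.\<close>
    also have "\<dots> = mat_range (X2 @\<^sub>c X3)"
      unfolding W_eq ST dims(1) by (rule image_mult_corner_diag[OF blocks(4) X23 d0])
    finally show ?thesis .
  qed
  ultimately show ?thesis
    unfolding S_def W_def by blast
qed

end
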